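(* Let $V_h$, $A$, $\delta$, $\alpha$, $\psi$, $D=A-\delta I$ and $B(t)=\frac1\alpha(tD+\delta I)$ be as in the context, and let $w:[0,1]\to V_h$ be the solution of the Cauchy problem $$B(t)\frac{dw}{dt}+Dw=0,\quad 0<t\le1,\qquad w(0)=\delta^{-\alpha}\psi .$$ Let $\sigma_0=\frac{2+\alpha}{6\alpha}$. Then the three-level scheme with weight $\sigma_0$ approximates this equation with fourth order: for $\tau=1/N$, $t_n=n\tau$, $$B(t_n)\frac{w(t_{n+1})-w(t_{n-1})}{2\tau}+D\big(\sigma_0 w(t_{n+1})+(1-2\sigma_0)w(t_n)+\sigma_0 w(t_{n-1})\big)=\mathcal{O}(\tau^4),\quad n=1,2,\dots,N-1,$$ where $\mathcal{O}(\tau^4)$ means that the $L_2(\Omega)$-norm of the left-hand side is at most $C\tau^4$ with a constant $C$ independent of $\tau$ and $n$.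
   Context: Let $\Omega\subset\mathbb{R}^d$, $d=2,3$, be a bounded domain with Lipschitz continuous boundary, and let $(u,v)=\int_\Omega uv\,d\bm{x}$, $\|u\|=(u,u)^{1/2}$ be the inner product and norm of $L_2(\Omega)$. Let $V_h\subset H^1(\Omega)$ be a fixed (finite-dimensional) finite element space with the inner product and norm of $L_2(\Omega)$. Let $$a(u,v)=\int_\Omega \big(k\,\mathrm{grad}\,u\cdot \mathrm{grad}\,v + c\,uv\big)d\bm{x}+\int_{\partial\Omega}\mu\,uv\,d\bm{x},$$ where $0<k_1\le k(\bm{x})\le k_2$, $c(\bm{x})\ge c_0>0$ and $\mu(\bm{x})\ge 0$. The discrete elliptic operator $A:V_h\to V_h$ is defined by $(Au,v)=a(u,v)$ for all $u,v\in V_h$. It is assumed that $\delta>0$ is a constant such that $A=A^*>\delta I$, i.e. $A$ is self-adjoint and $(Au,u)>\delta\|u\|^2$ for all nonzero $u\in V_h$. Here $I$ is the identity operator. Put $D=A-\delta I$, so $D=D^*>0$. Let $0<\alpha<1$ and $\psi\in V_h$. The constant $C$ may depend on $V_h$, $A$, $\delta$, $\alpha$ and $\psi$. *)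

theory Defs
  imports "HOL-Analysis.Analysis"
begin

section \<open>Square-integrable functions modulo null sets\<close>

text \<open>
  The Hilbert space \<open>L\<^sub>2\<close> over the whole Euclidean space, as a quotient type.
  The space \<open>L\<^sub>2(\<Omega>)\<close> is obtained below as its subspace of functions vanishing
  almost everywhere outside \<open>\<Omega>\<close> (extension by zero), so that one type serves all domains.
\<close>

definition sq_int :: "('a::euclidean_space \<Rightarrow> real) \<Rightarrow> bool" where
  "sq_int f \<longleftrightarrow> f \<in> borel_measurable lborel \<and> integrable lborel (\<lambda>x. (f x)\<^sup>2)"

definition l2_rel :: "('a::euclidean_space \<Rightarrow> real) \<Rightarrow> ('a \<Rightarrow> real) \<Rightarrow> bool" where
  "l2_rel f g \<longleftrightarrow> sq_int f \<and> sq_int g \<and> (AE x in lborel. f x = g x)"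

lemma sq_int_mult:
  assumes "sq_int f" "sq_int g"
  shows "integrable lborel (\<lambda>x. f x * g x)"
proof (rule Bochner_Integration.integrable_bound)
  show "integrable lborel (\<lambda>x. (f x)\<^sup>2 + (g x)\<^sup>2)"
    using assms by (auto simp: sq_int_def)
  show "(\<lambda>x. f x * g x) \<in> borel_measurable lborel"
    using assms by (auto simp: sq_int_def)
  have "\<bar>a * b\<bar> \<le> a\<^sup>2 + b\<^sup>2" for a b :: real
  proof -
    have "0 \<le> (\<bar>a\<bar> - \<bar>b\<bar>)\<^sup>2" by simp
    then have "2 * (\<bar>a\<bar> * \<bar>b\<bar>) \<le> a\<^sup>2 + b\<^sup>2"
      by (simp add: power2_eq_square algebra_simps)
    moreover have "0 \<le> \<bar>a\<bar> * \<bar>b\<bar>" by simp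
    ultimately show ?thesis unfolding abs_mult by linarith
  qed
  then show "AE x in lborel. norm (f x * g x) \<le> norm ((f x)\<^sup>2 + (g x)\<^sup>2)"
    by (intro AE_I2) (simp add: abs_of_nonneg)
qed

lemma sq_int_zero: "sq_int (\<lambda>_. 0)"
  by (simp add: sq_int_def)

lemma sq_int_scale: "sq_int f \<Longrightarrow> sq_int (\<lambda>x. c * f x)"
  by (auto simp: sq_int_def power_mult_distrib)

lemma sq_int_add:
  assumes "sq_int f" "sq_int g"
  shows "sq_int (\<lambda>x. f x + g x)"
proof -
  have "integrable lborel (\<lambda>x. (f x)\<^sup>2 + (g x)\<^sup>2 + 2 * (f x * g x))"
    using assms sq_int_mult[OF assms] by (auto simp: sq_int_def)
  then show ?thesis
    using assms by (auto simp: sq_int_def power2_sum mult.assoc)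
qed

lemma sq_int_minus: "sq_int f \<Longrightarrow> sq_int (\<lambda>x. - f x)"
  using sq_int_scale[of f "- 1"] by simp

lemma sq_int_diff: "sq_int f \<Longrightarrow> sq_int g \<Longrightarrow> sq_int (\<lambda>x. f x - g x)"
  using sq_int_add[of f "\<lambda>x. - g x"] by (simp add: sq_int_minus)

quotient_type (overloaded) 'a l2fun = "'a::euclidean_space \<Rightarrow> real" / partial: l2_rel
proof (rule part_equivpI)
  show "\<exists>x. l2_rel x (x :: 'a \<Rightarrow> real)"
    by (intro exI[of _ "\<lambda>_. 0"]) (simp add: l2_rel_def sq_int_zero)
  show "symp (l2_rel :: ('a \<Rightarrow> real) \<Rightarrow> _)"
    by (intro sympI) (auto simp: l2_rel_def elim: AE_mp)
  show "transp (l2_rel :: ('a \<Rightarrow> real) \<Rightarrow> _)"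
  proof (intro transpI)
    fix f g h :: "'a \<Rightarrow> real"
    assume "l2_rel f g" "l2_rel g h"
    then show "l2_rel f h"
      unfolding l2_rel_def by (auto elim: AE_mp)
  qed
qed

instantiation l2fun :: (euclidean_space) real_inner
begin

lift_definition zero_l2fun :: "'a l2fun" is "\<lambda>_. 0"
  by (simp add: l2_rel_def sq_int_zero)

lift_definition plus_l2fun :: "'a l2fun \<Rightarrow> 'a l2fun \<Rightarrow> 'a l2fun" is "\<lambda>f g x. f x + g x"
  unfolding l2_rel_def by (auto intro: sq_int_add elim: AE_mp)

lift_definition scaleR_l2fun :: "real \<Rightarrow> 'a l2fun \<Rightarrow> 'a l2fun" is "\<lambda>c f x. c * f x"
  unfolding l2_rel_def by (auto intro: sq_int_scale elim: AE_mp)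

lift_definition inner_l2fun :: "'a l2fun \<Rightarrow> 'a l2fun \<Rightarrow> real"
  is "\<lambda>f g. LINT x|lborel. f x * g x"
proof -
  fix f f' g g' :: "'a \<Rightarrow> real"
  assume *: "l2_rel f f'" "l2_rel g g'"
  then have [measurable]: "f \<in> borel_measurable lborel" "f' \<in> borel_measurable lborel"
    "g \<in> borel_measurable lborel" "g' \<in> borel_measurable lborel"
    by (auto simp: l2_rel_def sq_int_def)
  from * have "AE x in lborel. f x = f' x" "AE x in lborel. g x = g' x"
    by (auto simp: l2_rel_def)
  then have "AE x in lborel. f x * g x = f' x * g' x"
    by eventually_elim simp
  then show "(LINT x|lborel. f x * g x) = (LINT x|lborel. f' x * g' x)"
    by (intro integral_cong_AE) auto
qed

lift_definition uminus_l2fun :: "'a l2fun \<Rightarrow> 'a l2fun" is "\<lambda>f x. - f x"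
  unfolding l2_rel_def by (auto intro: sq_int_minus elim: AE_mp)

lift_definition minus_l2fun :: "'a l2fun \<Rightarrow> 'a l2fun \<Rightarrow> 'a l2fun" is "\<lambda>f g x. f x - g x"
  unfolding l2_rel_def by (auto intro: sq_int_diff elim: AE_mp)

definition norm_l2fun :: "'a l2fun \<Rightarrow> real" where
  "norm u = sqrt (inner u u)" for u :: "'a l2fun"

definition sgn_l2fun :: "'a l2fun \<Rightarrow> 'a l2fun" where
  "sgn u = inverse (norm u) *\<^sub>R u" for u :: "'a l2fun"

definition dist_l2fun :: "'a l2fun \<Rightarrow> 'a l2fun \<Rightarrow> real" where
  "dist u v = norm (u - v)" for u v :: "'a l2fun"

definition uniformity_l2fun :: "('a l2fun \<times> 'a l2fun) filter" where
  "uniformity_l2fun = (INF e\<in>{0<..}. principal {(u, v). dist u v < e})"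

definition open_l2fun :: "'a l2fun set \<Rightarrow> bool" where
  "open_l2fun U \<longleftrightarrow> (\<forall>u\<in>U. eventually (\<lambda>(u', v). u' = u \<longrightarrow> v \<in> U) uniformity)"

instance
proof
  fix u v w :: "'a l2fun" and r s :: real
  show "u + v + w = u + (v + w)"
    by transfer (auto simp: l2_rel_def add.assoc intro!: sq_int_add)
  show "u + v = v + u"
    by transfer (auto simp: l2_rel_def add.commute intro!: sq_int_add)
  show zero: "0 + u = u"
    by transfer (auto simp: l2_rel_def)
  show "- u + u = 0"
    by transfer (auto simp: l2_rel_def sq_int_zero)
  show "u - v = u + - v"
    by transfer (auto simp: l2_rel_def intro!: sq_int_diff)
  show "r *\<^sub>R (u + v) = r *\<^sub>R u + r *\<^sub>R v"
    by transfer (auto simp: l2_rel_def distrib_left intro!: sq_int_add sq_int_scale)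
  show "(r + s) *\<^sub>R u = r *\<^sub>R u + s *\<^sub>R u"
    by transfer (auto simp: l2_rel_def distrib_right intro!: sq_int_add sq_int_scale)
  show "r *\<^sub>R s *\<^sub>R u = (r * s) *\<^sub>R u"
    by transfer (auto simp: l2_rel_def mult.assoc intro!: sq_int_scale)
  show "1 *\<^sub>R u = u"
    by transfer (auto simp: l2_rel_def)
  show "sgn u = inverse (norm u) *\<^sub>R u"
    by (rule sgn_l2fun_def)
  show "dist u v = norm (u - v)"
    by (rule dist_l2fun_def)
  show "uniformity = (INF e\<in>{0<..}. principal {(u :: 'a l2fun, v). dist u v < e})"
    by (rule uniformity_l2fun_def)
  show "open U \<longleftrightarrow> (\<forall>u\<in>U. eventually (\<lambda>(u', v). u' = u \<longrightarrow> v \<in> U) uniformity)" for U :: "'a l2fun set"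
    by (rule open_l2fun_def)
  show "inner u v = inner v u"
    by transfer (simp add: mult.commute)
  show "inner (u + v) w = inner u w + inner v w"
    by transfer (auto simp: l2_rel_def distrib_right sq_int_mult)
  show "inner (r *\<^sub>R u) v = r * inner u v"
    by transfer (simp add: mult.assoc)
  show "0 \<le> inner u u"
    by transfer simp
  show "inner u u = 0 \<longleftrightarrow> u = 0"
  proof transfer
    fix f :: "'a \<Rightarrow> real"
    assume f: "l2_rel f f"
    then have "(LINT x|lborel. f x * f x) = 0 \<longleftrightarrow> (AE x in lborel. f x * f x = 0)"
      by (intro integral_nonneg_eq_0_iff_AE) (auto simp: l2_rel_def sq_int_mult)
    with f show "(LINT x|lborel. f x * f x) = 0 \<longleftrightarrow> l2_rel f (\<lambda>_. 0)"
      by (simp add: l2_rel_def sq_int_zero)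
  qed
  show "norm u = sqrt (inner u u)"
    by (rule norm_l2fun_def)
qed

end

lemma rep_l2fun_sq_int: "sq_int (rep_l2fun u)"
  using Quotient_rep_reflp[OF Quotient_l2fun, of u] by (simp add: l2_rel_def)

lemma inner_l2fun_eq: "inner u v = (LINT x|lborel. rep_l2fun u x * rep_l2fun v x)"
  by (simp add: inner_l2fun_def)

definition L2_on :: "'a::euclidean_space set \<Rightarrow> 'a l2fun set" where
  "L2_on \<Omega> = {u. AE x in lborel. x \<notin> \<Omega> \<longrightarrow> rep_l2fun u x = 0}"

lemma inner_L2_on:
  assumes "u \<in> L2_on \<Omega>" "\<Omega> \<in> sets borel"
  shows "inner u v = (LINT x:\<Omega>|lborel. rep_l2fun u x * rep_l2fun v x)"
proof -
  have [measurable]: "rep_l2fun u \<in> borel_measurable lborel" "rep_l2fun v \<in> borel_measurable lborel"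
    "\<Omega> \<in> sets borel"
    using rep_l2fun_sq_int[of u] rep_l2fun_sq_int[of v] assms by (auto simp: sq_int_def)
  have "AE x in lborel. x \<notin> \<Omega> \<longrightarrow> rep_l2fun u x = 0"
    using assms by (simp add: L2_on_def)
  then have "AE x in lborel. rep_l2fun u x * rep_l2fun v x
      = indicator \<Omega> x *\<^sub>R (rep_l2fun u x * rep_l2fun v x)"
    by eventually_elim (auto simp: indicator_def)
  then show ?thesis
    unfolding inner_l2fun_eq set_lebesgue_integral_def
    by (intro integral_cong_AE) auto
qed


section \<open>Lipschitz domains and surface measure\<close>

text \<open>
  Near each boundary point \<open>\<Omega>\<close> is the part of a ball lying above the graph of a Lipschitz
  function defined on the hyperplane orthogonal to some unit vector \<open>e\<close>.
\<close>

definition lipschitz_boundary :: "'a::euclidean_space set \<Rightarrow> bool" where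
  "lipschitz_boundary \<Omega> \<longleftrightarrow>
    (\<forall>p\<in>frontier \<Omega>. \<exists>r>0. \<exists>e L \<gamma>. norm e = 1 \<and> L-lipschitz_on {y. e \<bullet> y = 0} (\<gamma> :: 'a \<Rightarrow> real) \<and>
      \<Omega> \<inter> ball p r = {x \<in> ball p r. \<gamma> (x - (e \<bullet> x) *\<^sub>R e) < e \<bullet> x})"

definition bounded_lipschitz_domain :: "'a::euclidean_space set \<Rightarrow> bool" where
  "bounded_lipschitz_domain \<Omega> \<longleftrightarrow>
    \<Omega> \<noteq> {} \<and> open \<Omega> \<and> connected \<Omega> \<and> bounded \<Omega> \<and> lipschitz_boundary \<Omega>"

text \<open>
  \<open>s\<close>-dimensional Hausdorff measure, normalised by the volume of the \<open>s\<close>-dimensional unit ball.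
  The covers consist of bounded sets because \<^const>\<open>diameter\<close> is meaningless on unbounded
  ones. The case \<open>s = 0\<close> is not used.
  The outer measure is metric, hence countably additive on Borel sets, so \<^const>\<open>measure_of\<close>
  does not collapse to the zero measure.
\<close>

definition hausdorff_pre :: "nat \<Rightarrow> real \<Rightarrow> 'a::euclidean_space set \<Rightarrow> ennreal" where
  "hausdorff_pre s \<epsilon> E =
    (INF C\<in>{C :: nat \<Rightarrow> 'a set. E \<subseteq> (\<Union>j. C j) \<and> (\<forall>j. bounded (C j) \<and> diameter (C j) \<le> \<epsilon>)}.
      \<Sum>j. ennreal (unit_ball_vol (real s) * (diameter (C j) / 2) ^ s))"

definition hausdorff_outer :: "nat \<Rightarrow> 'a::euclidean_space set \<Rightarrow> ennreal" where
  "hausdorff_outer s E = (SUP \<epsilon>\<in>{0<..}. hausdorff_pre s \<epsilon> E)"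

definition hausdorff_measure :: "nat \<Rightarrow> 'a::euclidean_space measure" where
  "hausdorff_measure s = measure_of UNIV (sets borel) (hausdorff_outer s)"

text \<open>On a Lipschitz boundary the surface measure is the Hausdorff measure of codimension one.\<close>

abbreviation surface_measure :: "'a::euclidean_space measure" where
  "surface_measure \<equiv> hausdorff_measure (DIM('a) - 1)"


section \<open>The Sobolev space of order one\<close>

definition partial_deriv :: "'a::euclidean_space \<Rightarrow> ('a \<Rightarrow> real) \<Rightarrow> 'a \<Rightarrow> real" where
  "partial_deriv b \<phi> x = frechet_derivative \<phi> (at x) b"

primrec C_order :: "nat \<Rightarrow> ('a::euclidean_space \<Rightarrow> real) \<Rightarrow> bool" where
  "C_order 0 \<phi> \<longleftrightarrow> continuous_on UNIV \<phi>"
| "C_order (Suc m) \<phi> \<longleftrightarrow>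
    (\<forall>x. \<phi> differentiable (at x)) \<and> (\<forall>b\<in>Basis. C_order m (partial_deriv b \<phi>))"

definition smooth :: "('a::euclidean_space \<Rightarrow> real) \<Rightarrow> bool" where
  "smooth \<phi> \<longleftrightarrow> (\<forall>m. C_order m \<phi>)"

definition test_function :: "'a::euclidean_space set \<Rightarrow> ('a \<Rightarrow> real) \<Rightarrow> bool" where
  "test_function \<Omega> \<phi> \<longleftrightarrow>
    smooth \<phi> \<and> compact (closure {x. \<phi> x \<noteq> 0}) \<and> closure {x. \<phi> x \<noteq> 0} \<subseteq> \<Omega>"

definition has_weak_partial ::
    "'a::euclidean_space set \<Rightarrow> 'a \<Rightarrow> 'a l2fun \<Rightarrow> 'a l2fun \<Rightarrow> bool" where
  "has_weak_partial \<Omega> b u g \<longleftrightarrow> g \<in> L2_on \<Omega> \<and>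
    (\<forall>\<phi>. test_function \<Omega> \<phi> \<longrightarrow>
      (LINT x:\<Omega>|lborel. rep_l2fun u x * partial_deriv b \<phi> x)
        = - (LINT x:\<Omega>|lborel. rep_l2fun g x * \<phi> x))"

definition H1 :: "'a::euclidean_space set \<Rightarrow> 'a l2fun set" where
  "H1 \<Omega> = {u \<in> L2_on \<Omega>. \<forall>b\<in>Basis. \<exists>g. has_weak_partial \<Omega> b u g}"

definition weak_partial :: "'a::euclidean_space set \<Rightarrow> 'a \<Rightarrow> 'a l2fun \<Rightarrow> 'a l2fun" where
  "weak_partial \<Omega> b u = (THE g. has_weak_partial \<Omega> b u g)"

definition grad :: "'a::euclidean_space set \<Rightarrow> 'a l2fun \<Rightarrow> 'a \<Rightarrow> 'a" where
  "grad \<Omega> u x = (\<Sum>b\<in>Basis. rep_l2fun (weak_partial \<Omega> b u) x *\<^sub>R b)"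

text \<open>
  The trace is the \<open>L\<^sub>2(\<partial>\<Omega>)\<close>-limit of the boundary values of smooth functions approximating \<open>u\<close>
  in \<open>H\<^sup>1(\<Omega>)\<close>. On a bounded Lipschitz domain it exists for every \<open>u \<in> H\<^sup>1(\<Omega>)\<close> and is unique
  up to surface-null sets, so the choice of a representative below is immaterial.
\<close>

definition has_trace :: "'a::euclidean_space set \<Rightarrow> 'a l2fun \<Rightarrow> ('a \<Rightarrow> real) \<Rightarrow> bool" where
  "has_trace \<Omega> u g \<longleftrightarrow> g \<in> borel_measurable borel \<and>
    (\<exists>\<phi> :: nat \<Rightarrow> 'a \<Rightarrow> real. (\<forall>j. smooth (\<phi> j)) \<and>
      (\<lambda>j. \<integral>\<^sup>+x\<in>\<Omega>. ennreal ((\<phi> j x - rep_l2fun u x)\<^sup>2) \<partial>lborel) \<longlonglongrightarrow> 0 \<and>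
      (\<forall>b\<in>Basis. (\<lambda>j. \<integral>\<^sup>+x\<in>\<Omega>. ennreal ((partial_deriv b (\<phi> j) x
          - rep_l2fun (weak_partial \<Omega> b u) x)\<^sup>2) \<partial>lborel) \<longlonglongrightarrow> 0) \<and>
      (\<lambda>j. \<integral>\<^sup>+x\<in>frontier \<Omega>. ennreal ((\<phi> j x - g x)\<^sup>2) \<partial>surface_measure) \<longlonglongrightarrow> 0)"

definition trace_on_boundary :: "'a::euclidean_space set \<Rightarrow> 'a l2fun \<Rightarrow> 'a \<Rightarrow> real" where
  "trace_on_boundary \<Omega> u = (SOME g. has_trace \<Omega> u g)"


section \<open>The discrete elliptic problem\<close>

definition bilinear_a :: "'a::euclidean_space set \<Rightarrow> ('a \<Rightarrow> real) \<Rightarrow> ('a \<Rightarrow> real) \<Rightarrow> ('a \<Rightarrow> real) \<Rightarrow>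
    'a l2fun \<Rightarrow> 'a l2fun \<Rightarrow> real" where
  "bilinear_a \<Omega> k c \<mu> u v =
    (LINT x:\<Omega>|lborel. k x * (grad \<Omega> u x \<bullet> grad \<Omega> v x) + c x * rep_l2fun u x * rep_l2fun v x)
    + (LINT x:frontier \<Omega>|surface_measure.
        \<mu> x * trace_on_boundary \<Omega> u x * trace_on_boundary \<Omega> v x)"

text \<open>
  Conditions on the coefficients: the pointwise bounds, measurability, and integrability
  of the terms in \<^const>\<open>bilinear_a\<close>, without which the form is undefined. The term with \<open>k\<close>
  is integrable automatically, since \<open>k\<close> is bounded and gradients are square-integrable.
\<close>

definition admissible_coeffs :: "'a::euclidean_space set \<Rightarrow> 'a l2fun set \<Rightarrow>
    ('a \<Rightarrow> real) \<Rightarrow> ('a \<Rightarrow> real) \<Rightarrow> ('a \<Rightarrow> real) \<Rightarrow> real \<Rightarrow> real \<Rightarrow> real \<Rightarrow> bool" where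
  "admissible_coeffs \<Omega> V k c \<mu> k1 k2 c0 \<longleftrightarrow>
    set_borel_measurable borel \<Omega> k \<and> set_borel_measurable borel \<Omega> c \<and>
    set_borel_measurable borel (frontier \<Omega>) \<mu> \<and>
    0 < k1 \<and> (\<forall>x\<in>\<Omega>. k1 \<le> k x \<and> k x \<le> k2) \<and>
    0 < c0 \<and> (\<forall>x\<in>\<Omega>. c0 \<le> c x) \<and>
    (\<forall>x\<in>frontier \<Omega>. 0 \<le> \<mu> x) \<and>
    (\<forall>u\<in>V. \<forall>v\<in>V. set_integrable lborel \<Omega> (\<lambda>x. c x * rep_l2fun u x * rep_l2fun v x) \<and>
      set_integrable surface_measure (frontier \<Omega>)
        (\<lambda>x. \<mu> x * trace_on_boundary \<Omega> u x * trace_on_boundary \<Omega> v x))"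

definition finite_dim_subspace :: "'b::real_vector set \<Rightarrow> bool" where
  "finite_dim_subspace V \<longleftrightarrow> (\<exists>S. finite S \<and> V = span S)"

definition D_op :: "('b::real_vector \<Rightarrow> 'b) \<Rightarrow> real \<Rightarrow> 'b \<Rightarrow> 'b" where
  "D_op A \<delta> u = A u - \<delta> *\<^sub>R u"

definition B_op :: "('b::real_vector \<Rightarrow> 'b) \<Rightarrow> real \<Rightarrow> real \<Rightarrow> real \<Rightarrow> 'b \<Rightarrow> 'b" where
  "B_op A \<delta> \<alpha> t u = (1 / \<alpha>) *\<^sub>R (t *\<^sub>R D_op A \<delta> u + \<delta> *\<^sub>R u)"

definition cauchy_solution :: "'b::real_normed_vector set \<Rightarrow> ('b \<Rightarrow> 'b) \<Rightarrow> real \<Rightarrow> real \<Rightarrow> 'b \<Rightarrow>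
    (real \<Rightarrow> 'b) \<Rightarrow> bool" where
  "cauchy_solution V A \<delta> \<alpha> \<psi> w \<longleftrightarrow>
    (\<forall>t\<in>{0..1}. w t \<in> V) \<and> continuous_on {0..1} w \<and>
    w 0 = (\<delta> powr (- \<alpha>)) *\<^sub>R \<psi> \<and>
    (\<forall>t\<in>{0<..1}. \<exists>w'\<in>V. (w has_vector_derivative w') (at t within {0..1}) \<and>
      B_op A \<delta> \<alpha> t w' + D_op A \<delta> (w t) = 0)"

end

theory Submission
  imports Defs
begin

text \<open>
  Put \<open>T(t) = \<alpha> B(t) = t D + \<delta> I\<close>, so that the equation reads \<open>T w' = -\<alpha> D w\<close>. Since
  \<open>dT/dt = D\<close>, differentiating it \<open>k\<close> times gives \<open>T w\<^bsup>(k+1)\<^esup> = -(\<alpha> + k) D w\<^bsup>(k)\<^esup>\<close>.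
  By Taylor's formula the central difference is \<open>w' + (\<tau>\<^sup>2/6) w''' + O(\<tau>\<^sup>4)\<close> and the weighted
  average is \<open>w + \<sigma> \<tau>\<^sup>2 w'' + O(\<tau>\<^sup>4)\<close>. In the residual the terms without \<open>\<tau>\<close> cancel by the
  equation itself, and the terms of order \<open>\<tau>\<^sup>2\<close> by its second derivative
  \<open>T w''' = -(\<alpha> + 2) D w''\<close>, precisely when \<open>\<sigma> = (2 + \<alpha>) / (6 \<alpha>)\<close>
  (lemma \<open>residual_bound\<close>).

  What remains is that \<open>w\<close> is smooth with derivatives bounded up to \<open>t = 0\<close>, where the
  equation is not imposed and \<open>w\<close> is only continuous. Positivity of \<open>D\<close> gives
  \<open>\<delta> \<parallel>u\<parallel> \<le> \<parallel>T(t) u\<parallel>\<close> for \<open>t \<ge> 0\<close>, so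
  \<open>T(t)\<close> is invertible on the finite-dimensional space and solutions of \<open>T(t) x = y\<close> depend continuously on
  \<open>t\<close> and \<open>y\<close> (lemma \<open>tendsto_solution\<close>). Solving the differentiated equations for
  the highest derivative therefore yields functions continuous on \<open>[0, 1]\<close>, hence bounded, and
  passing to the limit in difference quotients shows that each is the derivative of the previous
  one on \<open>(0, 1)\<close> (lemma \<open>has_vector_derivative_deriv_chain\<close>).

  The operator is given on \<open>V\<^sub>h\<close> alone. Symmetry makes it linear there, and it is
  replaced by a bounded linear extension to all of \<open>L\<^sub>2\<close> (lemma
  \<open>bounded_linear_extension\<close>), which makes the calculus of bounded linear maps available.
\<close>

section \<open>Calculus of vector-valued functions\<close>

lemma has_vector_derivative_iff_slope:
  fixes f :: "real \<Rightarrow> 'a::real_normed_vector"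
  shows "(f has_vector_derivative d) (at t within S)
    \<longleftrightarrow> ((\<lambda>s. (f s - f t) /\<^sub>R (s - t)) \<longlongrightarrow> d) (at t within S)"
proof -
  have eq: "norm (f s - f t - (s - t) *\<^sub>R d) / norm (s - t) = norm ((f s - f t) /\<^sub>R (s - t) - d)"
    if "s \<noteq> t" for s
  proof -
    have "(f s - f t) /\<^sub>R (s - t) - d = (f s - f t - (s - t) *\<^sub>R d) /\<^sub>R (s - t)"
      using that by (simp add: scaleR_diff_right)
    then show ?thesis by (simp add: divide_inverse mult.commute)
  qed
  have "(f has_vector_derivative d) (at t within S)
    \<longleftrightarrow> ((\<lambda>s. norm (f s - f t - (s - t) *\<^sub>R d) / norm (s - t)) \<longlongrightarrow> 0) (at t within S)"
    unfolding has_vector_derivative_def has_derivative_iff_norm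
    by (simp add: bounded_linear_scaleR_left)
  also have "\<dots> \<longleftrightarrow> ((\<lambda>s. norm ((f s - f t) /\<^sub>R (s - t) - d)) \<longlongrightarrow> 0) (at t within S)"
    by (intro tendsto_cong) (auto simp: eventually_at_filter eq[unfolded real_norm_def])
  also have "\<dots> \<longleftrightarrow> ((\<lambda>s. (f s - f t) /\<^sub>R (s - t)) \<longlongrightarrow> d) (at t within S)"
    by (simp add: tendsto_norm_zero_iff LIM_zero_iff)
  finally show ?thesis .
qed

text \<open>
  By induction on the order: the derivative of the remainder of \<open>f 0\<close> is the remainder of
  \<open>f 1\<close>. Derivatives are needed in the open interval only, which matters because the solution
  of the Cauchy problem is merely continuous at \<open>0\<close> by hypothesis.
\<close>
lemma taylor_remainder_bound:
  fixes f :: "nat \<Rightarrow> real \<Rightarrow> 'a::real_normed_vector"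
  assumes "0 \<le> h"
    and "\<And>k. k < m \<Longrightarrow> continuous_on {0..h} (f k)"
    and "\<And>k x. k < m \<Longrightarrow> 0 < x \<Longrightarrow> x < h \<Longrightarrow> (f k has_vector_derivative f (Suc k) x) (at x)"
    and "\<And>x. 0 \<le> x \<Longrightarrow> x \<le> h \<Longrightarrow> norm (f m x) \<le> M"
  shows "norm (f 0 h - (\<Sum>k<m. (h ^ k / fact k) *\<^sub>R f k 0)) \<le> M * h ^ m / fact m"
  using assms
proof (induction m arbitrary: f h)
  case 0
  then show ?case by simp
next
  case (Suc m)
  show ?case
  proof (cases "h = 0")
    case True
    then show ?thesis
      by (simp add: sum.lessThan_Suc_shift del: sum.lessThan_Suc)
  next
    case False
    with Suc.prems have h: "0 < h" by simp
    let ?F = "\<lambda>x. f 0 x - (\<Sum>k<Suc m. (x ^ k / fact k) *\<^sub>R f k 0)"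
    let ?F' = "\<lambda>x. f (Suc 0) x - (\<Sum>k<m. (x ^ k / fact k) *\<^sub>R f (Suc k) 0)"
    let ?\<phi> = "\<lambda>x. M * x ^ Suc m / fact (Suc m)"
    have "norm (?F h - ?F 0) \<le> ?\<phi> h - ?\<phi> 0"
    proof (rule differentiable_bound_general[OF h, where f' = ?F' and \<phi>' = "\<lambda>x. M * x ^ m / fact m"])
      show "continuous_on {0..h} ?F"
        by (intro continuous_intros Suc.prems(2)) auto
      show "continuous_on {0..h} ?\<phi>"
        by (intro continuous_intros) auto
      fix x assume x: "0 < x" "x < h"
      have pow: "((\<lambda>x. (x ^ Suc k / fact (Suc k)) *\<^sub>R v) has_vector_derivative (x ^ k / fact k) *\<^sub>R v) (at x)"
        for k and v :: 'a
      proof -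
        have "((\<lambda>x. x ^ Suc k / fact (Suc k)) has_real_derivative real (Suc k) * x ^ k / fact (Suc k)) (at x)"
          by (auto intro!: derivative_eq_intros simp del: power_Suc fact_Suc)
        also have "real (Suc k) * x ^ k / fact (Suc k) = x ^ k / fact k"
          by (simp add: fact_Suc del: of_nat_Suc)
        finally show ?thesis
          unfolding has_real_derivative_iff_has_vector_derivative
          by (rule bounded_linear.has_vector_derivative[OF bounded_linear_scaleR_left])
      qed
      have "(?F has_vector_derivative f (Suc 0) x -
          (0 + (\<Sum>k<m. (x ^ k / fact k) *\<^sub>R f (Suc k) 0))) (at x)"
        unfolding sum.lessThan_Suc_shift o_def
        by (intro has_vector_derivative_diff has_vector_derivative_add has_vector_derivative_sum
             Suc.prems(3) pow x) (auto intro: derivative_eq_intros)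
      then show "(?F has_vector_derivative ?F' x) (at x)" by simp
      have "(?\<phi> has_real_derivative M * (real (Suc m) * x ^ m) / fact (Suc m)) (at x)"
        by (auto intro!: derivative_eq_intros simp del: power_Suc fact_Suc)
      also have "M * (real (Suc m) * x ^ m) / fact (Suc m) = M * x ^ m / fact m"
        by (simp add: fact_Suc del: of_nat_Suc)
      finally show "(?\<phi> has_vector_derivative M * x ^ m / fact m) (at x)"
        by (simp add: has_real_derivative_iff_has_vector_derivative)
      show "norm (?F' x) \<le> M * x ^ m / fact m"
        using x by (intro Suc.IH[of x "\<lambda>k. f (Suc k)"] Suc.prems(3,4) continuous_on_subset[OF Suc.prems(2)])
          auto
    qed
    moreover have "?F 0 = 0"
      by (simp add: sum.lessThan_Suc_shift del: sum.lessThan_Suc)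
    ultimately show ?thesis by simp
  qed
qed

text \<open>
  With \<open>\<epsilon> = -1\<close> the even terms of the Taylor sum cancel, with \<open>\<epsilon> = 1\<close> the odd ones.
\<close>
lemma symmetric_taylor_remainder_bound:
  fixes f :: "nat \<Rightarrow> real \<Rightarrow> 'a::real_normed_vector"
  assumes h: "0 \<le> h" "a \<le> t - h" "t + h \<le> b"
    and cont: "\<And>k. continuous_on {a..b} (f k)"
    and deriv: "\<And>k x. a < x \<Longrightarrow> x < b \<Longrightarrow> (f k has_vector_derivative f (Suc k) x) (at x)"
    and bound: "\<And>x. a \<le> x \<Longrightarrow> x \<le> b \<Longrightarrow> norm (f m x) \<le> M"
    and \<epsilon>: "\<bar>\<epsilon>\<bar> = 1"
  shows "norm (f 0 (t + h) + \<epsilon> *\<^sub>R f 0 (t - h)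
      - (\<Sum>k<m. (h ^ k / fact k * (1 + \<epsilon> * (-1) ^ k)) *\<^sub>R f k t)) \<le> 2 * M * h ^ m / fact m"
proof -
  define g where "g k s = f k (t + s) + (\<epsilon> * (-1) ^ k) *\<^sub>R f k (t - s)" for k s
  have "norm (g 0 h - (\<Sum>k<m. (h ^ k / fact k) *\<^sub>R g k 0)) \<le> 2 * M * h ^ m / fact m"
  proof (rule taylor_remainder_bound[OF h(1)])
    show "continuous_on {0..h} (g k)" for k
      unfolding g_def using h
      by (intro continuous_intros continuous_on_compose2[OF cont]) auto
    show "(g k has_vector_derivative g (Suc k) x) (at x)" if "0 < x" "x < h" for k x
    proof -
      have 1: "((\<lambda>s. f k (t + s)) has_vector_derivative 1 *\<^sub>R f (Suc k) (t + x)) (at x)"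
        using that h
        by (intro vector_diff_chain_at[of _ 1 x "f k", unfolded o_def] deriv) (auto intro!: derivative_eq_intros)
      have 2: "((\<lambda>s. f k (t - s)) has_vector_derivative (-1) *\<^sub>R f (Suc k) (t - x)) (at x)"
        using that h
        by (intro vector_diff_chain_at[of _ "-1" x "f k", unfolded o_def] deriv) (auto intro!: derivative_eq_intros)
      show ?thesis
        unfolding g_def
        using has_vector_derivative_add[OF 1 bounded_linear.has_vector_derivative[OF bounded_linear_scaleR_right 2, of "\<epsilon> * (-1) ^ k"]]
        by simp
    qed
    show "norm (g m x) \<le> 2 * M" if "0 \<le> x" "x \<le> h" for x
    proof -
      have "norm (g m x) \<le> norm (f m (t + x)) + norm ((\<epsilon> * (-1) ^ m) *\<^sub>R f m (t - x))"
        unfolding g_def by (rule norm_triangle_ineq)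
      also have "\<dots> = norm (f m (t + x)) + norm (f m (t - x))"
        using \<epsilon> by (simp add: abs_mult power_abs)
      also have "\<dots> \<le> M + M"
        using that h by (intro add_mono bound) auto
      finally show ?thesis by simp
    qed
  qed
  moreover have "(h ^ k / fact k) *\<^sub>R g k 0 = (h ^ k / fact k * (1 + \<epsilon> * (-1) ^ k)) *\<^sub>R f k t" for k
    by (simp add: g_def algebra_simps)
  ultimately show ?thesis by (simp add: g_def)
qed

section \<open>Linear maps on finite-dimensional subspaces\<close>

lemma finite_dim_subspace_imp_subspace: "finite_dim_subspace V \<Longrightarrow> subspace V"
  by (auto simp: finite_dim_subspace_def)

text \<open>
  A linear map given on a finite-dimensional subspace is composed with the orthogonal projection
  onto it, written out in an orthogonal basis. (A zero vector in the spanning set is harmless,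
  its coefficient being a division by zero.)
\<close>
lemma bounded_linear_extension:
  fixes V :: "'b::real_inner set" and f :: "'b \<Rightarrow> 'c::real_normed_vector"
  assumes V: "finite_dim_subspace V"
    and add: "\<And>u v. u \<in> V \<Longrightarrow> v \<in> V \<Longrightarrow> f (u + v) = f u + f v"
    and scale: "\<And>r u. u \<in> V \<Longrightarrow> f (r *\<^sub>R u) = r *\<^sub>R f u"
  obtains L where "bounded_linear L" "\<And>u. u \<in> V \<Longrightarrow> L u = f u"
proof -
  from V obtain S where "finite S" "V = span S"
    by (auto simp: finite_dim_subspace_def)
  with basis_orthogonal[of S] obtain C
    where C: "finite C" "span C = V" "pairwise orthogonal C" by auto
  define L where "L u = (\<Sum>b\<in>C. (b \<bullet> u / (b \<bullet> b)) *\<^sub>R f b)" for u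
  have bl: "bounded_linear L"
    unfolding L_def divide_inverse
    by (intro bounded_linear_sum bounded_linear_scaleR_const bounded_linear_mult_const
        bounded_linear_inner_right)
  have sub: "subspace V" using V by (rule finite_dim_subspace_imp_subspace)
  have CV: "c \<in> V" if "c \<in> C" for c using C(2) span_base that by blast
  have f0: "f 0 = 0" using scale[of 0 0] sub by (simp add: subspace_0)
  have base: "L c = f c" if c: "c \<in> C" for c
  proof -
    have "L c = (\<Sum>b\<in>C. if b = c then f c else 0)"
      unfolding L_def
    proof (rule sum.cong[OF refl])
      fix b assume "b \<in> C"
      then show "(b \<bullet> c / (b \<bullet> b)) *\<^sub>R f b = (if b = c then f c else 0)"
        using C(3) c f0 by (auto simp: pairwise_def orthogonal_def)
    qed
    then show ?thesis using C(1) c by simp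
  qed
  have "u \<in> V \<and> L u = f u" if "u \<in> span C" for u
    using that
  proof (induction rule: span_induct_alt)
    case base
    then show ?case using f0 sub bl by (simp add: subspace_0 linear_simps)
  next
    case (step r c u)
    then show ?case
      using sub bl CV base add scale
      by (simp add: subspace_add subspace_scale linear_simps)
  qed
  then show ?thesis using that bl C(2) by blast
qed

text \<open>
  The image of a basis is independent. A vector outside the range could be added to it, giving an
  independent set larger than the basis.
\<close>
lemma inj_endomorphism_surj:
  fixes V :: "'b::real_vector set"
  assumes V: "finite_dim_subspace V" and f: "linear f" "f ` V \<subseteq> V"
    and inj: "\<And>u. u \<in> V \<Longrightarrow> f u = 0 \<Longrightarrow> u = 0"
  shows "f ` V = V"
proof (rule ccontr)
  assume "f ` V \<noteq> V"
  with f(2) obtain y where y: "y \<in> V" "y \<notin> f ` V" by blast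
  have sub: "subspace V" using V by (rule finite_dim_subspace_imp_subspace)
  from V obtain S where S: "finite S" "V = span S"
    by (auto simp: finite_dim_subspace_def)
  obtain B where B: "B \<subseteq> V" "independent B" "V \<subseteq> span B"
    by (rule maximal_independent_subset)
  have spB: "span B = V" using B sub by (metis span_minimal subset_antisym)
  have finB: "finite B"
    using real_vector.independent_span_bound[OF S(1) B(2)] B(1) S(2) by blast
  have injV: "inj_on f (span B)"
  proof (rule inj_onI)
    fix u v assume "u \<in> span B" "v \<in> span B" "f u = f v"
    then show "u = v"
      using inj[of "u - v"] sub spB f(1) by (simp add: linear_diff subspace_diff)
  qed
  have "independent (f ` B)"
    using f(1) B(2) injV by (rule linear_independent_injective_image)
  moreover have spf: "span (f ` B) = f ` V"
    using f(1) spB by (simp add: linear_span_image)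
  ultimately have "independent (insert y (f ` B))"
    using y by (intro real_vector.independent_insertI) auto
  moreover have "insert y (f ` B) \<subseteq> span B"
    using y B(1) f(2) spB by auto
  ultimately have "card (insert y (f ` B)) \<le> card B"
    using real_vector.independent_span_bound[OF finB] by blast
  moreover have "card (f ` B) = card B"
    using injV by (meson card_image inj_on_subset span_superset)
  moreover have "y \<notin> f ` B" using y B(1) by blast
  ultimately show False using finB by simp
qed

section \<open>The evolution equation\<close>

locale accretive_operator =
  fixes V :: "'b::real_inner set" and L :: "'b \<Rightarrow> 'b" and \<delta> :: real
  assumes finite_dim: "finite_dim_subspace V"
    and bounded_linear: "bounded_linear L"
    and maps: "\<And>u. u \<in> V \<Longrightarrow> L u \<in> V"
    and accretive: "\<And>u. u \<in> V \<Longrightarrow> 0 \<le> L u \<bullet> u"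
    and \<delta>_pos: "0 < \<delta>"
begin

lemma subspace: "subspace V"
  using finite_dim by (rule finite_dim_subspace_imp_subspace)

lemma linear: "linear L"
  using bounded_linear by (rule bounded_linear.linear)

text \<open>This is \<open>\<alpha> B(t)\<close> when \<open>L = D\<close>.\<close>
definition T :: "real \<Rightarrow> 'b \<Rightarrow> 'b" where
  "T t u = t *\<^sub>R L u + \<delta> *\<^sub>R u"

lemma bounded_linear_T: "bounded_linear (T t)"
  unfolding T_def
  by (intro bounded_linear_add bounded_linear_const_scaleR bounded_linear bounded_linear_ident)

lemma T_in: "u \<in> V \<Longrightarrow> T t u \<in> V"
  unfolding T_def by (intro subspace_add subspace_scale subspace maps)

lemma T_coercive:
  assumes "0 \<le> t" "u \<in> V"
  shows "\<delta> * norm u \<le> norm (T t u)"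
proof (cases "u = 0")
  case False
  have "\<delta> * norm u * norm u \<le> t * (L u \<bullet> u) + \<delta> * (u \<bullet> u)"
    using assms accretive[of u] by (simp add: power2_norm_eq_inner[symmetric] power2_eq_square)
  also have "\<dots> = T t u \<bullet> u"
    by (simp add: T_def inner_add_left)
  also have "\<dots> \<le> norm (T t u) * norm u"
    by (rule norm_cauchy_schwarz)
  finally show ?thesis using False by simp
qed simp

lemma T_inject:
  assumes "0 \<le> t" "u \<in> V" "v \<in> V" "T t u = T t v"
  shows "u = v"
proof -
  have "\<delta> * norm (u - v) \<le> norm (T t (u - v))"
    using assms subspace by (intro T_coercive subspace_diff)
  also have "T t (u - v) = 0"
    using assms(4) bounded_linear_T[of t] by (simp add: linear_simps)
  finally show ?thesis using \<delta>_pos by (simp add: mult_le_0_iff)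
qed

definition resolvent :: "real \<Rightarrow> 'b \<Rightarrow> 'b" where
  "resolvent t y = (SOME x. x \<in> V \<and> T t x = y)"

lemma
  assumes "0 \<le> t" "y \<in> V"
  shows resolvent_in: "resolvent t y \<in> V" and T_resolvent: "T t (resolvent t y) = y"
proof -
  have "T t ` V = V"
  proof (rule inj_endomorphism_surj[OF finite_dim])
    show "linear (T t)" using bounded_linear_T by (rule bounded_linear.linear)
    show "T t ` V \<subseteq> V" using T_in by blast
    show "u = 0" if "u \<in> V" "T t u = 0" for u
      using that T_inject[of t u 0] assms(1) subspace bounded_linear_T[of t]
      by (simp add: subspace_0 linear_simps)
  qed
  with assms(2) have "\<exists>x. x \<in> V \<and> T t x = y" by (metis imageE)
  from someI_ex[OF this] show "resolvent t y \<in> V" "T t (resolvent t y) = y"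
    unfolding resolvent_def by auto
qed

text \<open>
  Coercivity makes the solutions of \<open>T s (x s) = y s\<close> depend continuously on the data and on the
  parameter together, since \<open>T s (x s - x\<^sub>0) = y s - y\<^sub>0 - (s - t) L x\<^sub>0\<close>.
\<close>
lemma tendsto_solution:
  assumes sol: "eventually (\<lambda>s. 0 \<le> s \<and> x s \<in> V \<and> T s (x s) = y s) (at t within S)"
    and x\<^sub>0: "x\<^sub>0 \<in> V" "T t x\<^sub>0 = y\<^sub>0"
    and lim: "(y \<longlongrightarrow> y\<^sub>0) (at t within S)"
  shows "(x \<longlongrightarrow> x\<^sub>0) (at t within S)"
proof -
  let ?e = "\<lambda>s. norm (y s - y\<^sub>0 - (s - t) *\<^sub>R L x\<^sub>0) / \<delta>"
  have "((\<lambda>s. norm (y s - y\<^sub>0 - (s - t) *\<^sub>R L x\<^sub>0) / \<delta>) \<longlongrightarrow>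
      norm (y\<^sub>0 - y\<^sub>0 - (t - t) *\<^sub>R L x\<^sub>0) / \<delta>) (at t within S)"
    using \<delta>_pos by (intro tendsto_intros lim) auto
  then have e: "(?e \<longlongrightarrow> 0) (at t within S)" by simp
  have "eventually (\<lambda>s. norm (x s - x\<^sub>0) \<le> ?e s) (at t within S)"
    using sol
  proof eventually_elim
    case (elim s)
    then have "\<delta> * norm (x s - x\<^sub>0) \<le> norm (T s (x s - x\<^sub>0))"
      using x\<^sub>0 subspace by (intro T_coercive subspace_diff) auto
    also have "T s (x s - x\<^sub>0) = T s (x s) - T t x\<^sub>0 - (s - t) *\<^sub>R L x\<^sub>0"
      using linear by (simp add: T_def linear_diff algebra_simps)
    finally show ?case
      using elim x\<^sub>0 \<delta>_pos by (simp add: pos_le_divide_eq mult.commute)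
  qed
  then have "((\<lambda>s. x s - x\<^sub>0) \<longlongrightarrow> 0) (at t within S)"
    using e by (rule Lim_null_comparison)
  then show ?thesis by (simp add: LIM_zero_iff)
qed

text \<open>
  Differentiating \<open>T t w' = -\<alpha> L w\<close> formally \<open>k\<close> times, with \<open>dT/dt = L\<close>, gives
  \<open>T t w\<^bsup>(k+1)\<^esup> = -(\<alpha> + k) L w\<^bsup>(k)\<^esup>\<close>. These equations serve as a definition of the derivatives,
  valid up to \<open>t = 0\<close>.
\<close>
primrec deriv_chain :: "real \<Rightarrow> (real \<Rightarrow> 'b) \<Rightarrow> nat \<Rightarrow> real \<Rightarrow> 'b" where
  "deriv_chain \<alpha> w 0 = w"
| "deriv_chain \<alpha> w (Suc k) = (\<lambda>t. resolvent t (- (\<alpha> + real k) *\<^sub>R L (deriv_chain \<alpha> w k t)))"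

context
  fixes \<alpha> :: real and w :: "real \<Rightarrow> 'b"
  assumes w_in: "\<And>t. t \<in> {0..1} \<Longrightarrow> w t \<in> V"
    and w_cont: "continuous_on {0..1} w"
    and w_deriv: "\<And>t. t \<in> {0<..<1} \<Longrightarrow>
      \<exists>w'\<in>V. (w has_vector_derivative w') (at t) \<and> T t w' = - \<alpha> *\<^sub>R L (w t)"
begin

lemma deriv_chain_in: "t \<in> {0..1} \<Longrightarrow> deriv_chain \<alpha> w k t \<in> V"
proof (induction k)
  case (Suc k)
  then show ?case
    by (auto intro!: resolvent_in subspace_scale[OF subspace] maps simp del: scaleR_minus_left)
qed (simp add: w_in)

lemma T_deriv_chain:
  "t \<in> {0..1} \<Longrightarrow> T t (deriv_chain \<alpha> w (Suc k) t) = - (\<alpha> + real k) *\<^sub>R L (deriv_chain \<alpha> w k t)"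
  using deriv_chain_in
  by (auto intro!: T_resolvent subspace_scale[OF subspace] maps simp del: scaleR_minus_left)

lemma continuous_on_deriv_chain: "continuous_on {0..1} (deriv_chain \<alpha> w k)"
proof (induction k)
  case (Suc k)
  show ?case
    unfolding continuous_on_def
  proof
    fix t :: real assume t: "t \<in> {0..1}"
    show "(deriv_chain \<alpha> w (Suc k) \<longlongrightarrow> deriv_chain \<alpha> w (Suc k) t) (at t within {0..1})"
    proof (rule tendsto_solution[OF _ deriv_chain_in[OF t] T_deriv_chain[OF t]])
      show "\<forall>\<^sub>F s in at t within {0..1}. 0 \<le> s \<and> deriv_chain \<alpha> w (Suc k) s \<in> V \<and>
          T s (deriv_chain \<alpha> w (Suc k) s) = - (\<alpha> + real k) *\<^sub>R L (deriv_chain \<alpha> w k s)"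
        unfolding eventually_at_filter
        by (intro always_eventually allI impI conjI deriv_chain_in T_deriv_chain) auto
      show "((\<lambda>s. - (\<alpha> + real k) *\<^sub>R L (deriv_chain \<alpha> w k s)) \<longlongrightarrow>
          - (\<alpha> + real k) *\<^sub>R L (deriv_chain \<alpha> w k t)) (at t within {0..1})"
        using Suc t
        by (intro tendsto_scaleR tendsto_const bounded_linear.tendsto[OF bounded_linear])
          (simp add: continuous_on_def)
    qed
  qed
qed (simp add: w_cont)

text \<open>
  The difference quotients of \<open>w\<^bsup>(k+1)\<^esup>\<close> solve equations with the operators \<open>T s\<close> whose right-hand
  sides converge because \<open>w\<^bsup>(k)\<^esup>\<close> is differentiable.
\<close>
lemma has_vector_derivative_deriv_chain:
  assumes "t \<in> {0<..<1}"
  shows "(deriv_chain \<alpha> w k has_vector_derivative deriv_chain \<alpha> w (Suc k) t) (at t)"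
proof (induction k)
  case 0
  obtain w' where w': "w' \<in> V" "(w has_vector_derivative w') (at t)" "T t w' = - \<alpha> *\<^sub>R L (w t)"
    using w_deriv[OF assms] by blast
  have t01: "t \<in> {0..1}" using assms by simp
  have "w' = deriv_chain \<alpha> w (Suc 0) t"
    by (rule T_inject[of t])
      (use w'(1,3) assms T_deriv_chain[OF t01, of 0] deriv_chain_in[OF t01, of "Suc 0"] in auto)
  with w'(2) show ?case by simp
next
  case (Suc k)
  let ?u = "deriv_chain \<alpha> w (Suc k)" and ?v = "deriv_chain \<alpha> w k"
  have t: "t \<in> {0..1}" using assms by simp
  have near: "\<forall>\<^sub>F s in at t. s \<in> {0<..<1} \<and> s \<noteq> t"
    using assms by (intro eventually_conj eventually_at_in_open' eventually_neq_at_within) auto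
  show ?case
    unfolding has_vector_derivative_iff_slope
  proof (rule tendsto_solution[OF _ deriv_chain_in[OF t] T_deriv_chain[OF t]])
    let ?y = "\<lambda>s. - (\<alpha> + real k) *\<^sub>R L ((?v s - ?v t) /\<^sub>R (s - t)) - L (?u t)"
    show "\<forall>\<^sub>F s in at t. 0 \<le> s \<and> (?u s - ?u t) /\<^sub>R (s - t) \<in> V \<and>
        T s ((?u s - ?u t) /\<^sub>R (s - t)) = ?y s"
      using near
    proof eventually_elim
      case (elim s)
      then have s: "s \<in> {0..1}" "s \<noteq> t" by auto
      have "T s (?u s - ?u t) = T s (?u s) - T t (?u t) - (s - t) *\<^sub>R L (?u t)"
        using linear by (simp add: T_def linear_diff algebra_simps)
      also have "\<dots> = - (\<alpha> + real k) *\<^sub>R L (?v s - ?v t) - (s - t) *\<^sub>R L (?u t)"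
        unfolding T_deriv_chain[OF s(1)] T_deriv_chain[OF t]
        using linear by (simp add: linear_diff scaleR_diff_right)
      finally have "T s ((?u s - ?u t) /\<^sub>R (s - t))
          = (- (\<alpha> + real k) *\<^sub>R L (?v s - ?v t) - (s - t) *\<^sub>R L (?u t)) /\<^sub>R (s - t)"
        using bounded_linear_T[of s] by (simp only: linear_simps)
      also have "\<dots> = ?y s"
        unfolding linear_scale[OF linear] using s(2)
        by (simp only: scaleR_diff_right scaleR_scaleR) (simp add: mult.commute)
      finally show ?case
        using s(1) deriv_chain_in[OF s(1), of "Suc k"] deriv_chain_in[OF t, of "Suc k"] subspace
        by (simp add: subspace_diff subspace_scale del: deriv_chain.simps)
    qed
    have "(?y \<longlongrightarrow> - (\<alpha> + real k) *\<^sub>R L (?u t) - L (?u t)) (at t)"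
      using Suc unfolding has_vector_derivative_iff_slope
      by (intro tendsto_diff tendsto_scaleR tendsto_const bounded_linear.tendsto[OF bounded_linear])
    also have "- (\<alpha> + real k) *\<^sub>R L (?u t) - L (?u t) = - (\<alpha> + real (Suc k)) *\<^sub>R L (?u t)"
      by (simp add: algebra_simps del: deriv_chain.simps)
    finally show "(?y \<longlongrightarrow> - (\<alpha> + real (Suc k)) *\<^sub>R L (?u t)) (at t)" .
  qed
qed

lemma deriv_chain_bounded:
  obtains M where "\<And>t. t \<in> {0..1} \<Longrightarrow> norm (deriv_chain \<alpha> w k t) \<le> M"
proof -
  have "compact (deriv_chain \<alpha> w k ` {0..1})"
    by (intro compact_continuous_image continuous_on_deriv_chain) simp
  then show ?thesis
    using that by (meson bounded_iff compact_imp_bounded imageI)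
qed

text \<open>
  The residual splits into the Taylor polynomials of the central difference and of the
  weighted average, and their remainders. The terms of order zero cancel by
  \<open>T w' = -\<alpha> L w\<close>. The terms of order \<open>\<tau>\<^sup>2\<close> are \<open>(1/\<alpha>) T w''' / 6\<close> and \<open>\<sigma> L w''\<close>, and
  cancel by \<open>T w''' = -(\<alpha> + 2) L w''\<close> exactly for \<open>\<sigma> = (2 + \<alpha>) / (6 \<alpha>)\<close>.
\<close>
lemma residual_bound:
  assumes "\<alpha> > 0" and \<sigma>: "\<sigma> = (2 + \<alpha>) / (6 * \<alpha>)"
  obtains C where "\<And>t \<tau>. 0 < \<tau> \<Longrightarrow> 0 \<le> t - \<tau> \<Longrightarrow> t + \<tau> \<le> 1 \<Longrightarrow>
    norm ((1 / \<alpha>) *\<^sub>R T t ((1 / (2 * \<tau>)) *\<^sub>R (w (t + \<tau>) - w (t - \<tau>)))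
      + L (\<sigma> *\<^sub>R w (t + \<tau>) + (1 - 2 * \<sigma>) *\<^sub>R w t + \<sigma> *\<^sub>R w (t - \<tau>))) \<le> C * \<tau> ^ 4"
proof -
  obtain K where K: "0 < K" "\<And>u. norm (L u) \<le> norm u * K"
    using bounded_linear.pos_bounded[OF bounded_linear] by blast
  obtain M4 where M4: "\<And>t. t \<in> {0..1} \<Longrightarrow> norm (deriv_chain \<alpha> w 4 t) \<le> M4"
    using deriv_chain_bounded[of 4] by blast
  obtain M5 where M5: "\<And>t. t \<in> {0..1} \<Longrightarrow> norm (deriv_chain \<alpha> w 5 t) \<le> M5"
    using deriv_chain_bounded[of 5] by blast
  define C where "C = (K + \<delta>) * M5 / (120 * \<alpha>) + \<sigma> * K * M4 / 12"
  show ?thesis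
  proof (rule that)
    fix t \<tau> :: real assume \<tau>: "0 < \<tau>" "0 \<le> t - \<tau>" "t + \<tau> \<le> 1"
    then have t: "t \<in> {0..1}" by auto
    let ?W = "\<lambda>k. deriv_chain \<alpha> w k t"
    define E5 where "E5 = w (t + \<tau>) - w (t - \<tau>) - (2 * \<tau>) *\<^sub>R ?W 1 - (\<tau> ^ 3 / 3) *\<^sub>R ?W 3"
    define E4 where "E4 = w (t + \<tau>) + w (t - \<tau>) - 2 *\<^sub>R w t - \<tau>\<^sup>2 *\<^sub>R ?W 2"
    have taylor: "norm (w (t + \<tau>) + \<epsilon> *\<^sub>R w (t - \<tau>)
        - (\<Sum>k<m. (\<tau> ^ k / fact k * (1 + \<epsilon> * (-1) ^ k)) *\<^sub>R ?W k)) \<le> 2 * M * \<tau> ^ m / fact m"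
      if "\<bar>\<epsilon>\<bar> = 1" "\<And>t. t \<in> {0..1} \<Longrightarrow> norm (deriv_chain \<alpha> w m t) \<le> M" for \<epsilon> m M
      using symmetric_taylor_remainder_bound[of \<tau> 0 t 1 "deriv_chain \<alpha> w" m M \<epsilon>]
        \<tau> that continuous_on_deriv_chain has_vector_derivative_deriv_chain
      by simp
    have sum4: "(\<Sum>k<4. g k) = g 0 + g 1 + g 2 + g 3" and
      sum5: "(\<Sum>k<5. g k) = g 0 + g 1 + g 2 + g 3 + g 4" for g :: "nat \<Rightarrow> 'b"
      by (simp_all add: eval_nat_numeral)
    have E5: "norm E5 \<le> M5 * \<tau> ^ 5 / 60"
    proof -
      have "E5 = w (t + \<tau>) + (-1) *\<^sub>R w (t - \<tau>)
          - (\<Sum>k<5. (\<tau> ^ k / fact k * (1 + (-1) * (-1) ^ k)) *\<^sub>R ?W k)"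
        unfolding sum5 E5_def by (simp add: fact_numeral)
      then show ?thesis using taylor[of "-1" 5 M5, OF _ M5] by (simp add: fact_numeral)
    qed
    have E4: "norm E4 \<le> M4 * \<tau> ^ 4 / 12"
    proof -
      have "E4 = w (t + \<tau>) + 1 *\<^sub>R w (t - \<tau>)
          - (\<Sum>k<4. (\<tau> ^ k / fact k * (1 + 1 * (-1) ^ k)) *\<^sub>R ?W k)"
        unfolding sum4 E4_def by (simp add: fact_numeral)
      then show ?thesis using taylor[of 1 4 M4, OF _ M4] by (simp add: fact_numeral)
    qed
    have T1: "T t (?W 1) = - \<alpha> *\<^sub>R L (w t)"
      using T_deriv_chain[OF t, of 0] by simp
    have T3: "T t (?W 3) = - (\<alpha> + 2) *\<^sub>R L (?W 2)"
      using T_deriv_chain[OF t, of 2] by (simp add: numeral_3_eq_3 numeral_2_eq_2)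
    have central: "(1 / (2 * \<tau>)) *\<^sub>R (w (t + \<tau>) - w (t - \<tau>))
        = ?W 1 + (\<tau>\<^sup>2 / 6) *\<^sub>R ?W 3 + (1 / (2 * \<tau>)) *\<^sub>R E5"
    proof -
      have "1 / (2 * \<tau>) * (2 * \<tau>) = 1" "1 / (2 * \<tau>) * (\<tau> ^ 3 / 3) = \<tau>\<^sup>2 / 6"
        using \<tau>(1) by (simp_all add: power2_eq_square power3_eq_cube)
      then show ?thesis
        unfolding E5_def scaleR_diff_right scaleR_scaleR by simp
    qed
    have average: "\<sigma> *\<^sub>R w (t + \<tau>) + (1 - 2 * \<sigma>) *\<^sub>R w t + \<sigma> *\<^sub>R w (t - \<tau>)
        = w t + (\<sigma> * \<tau>\<^sup>2) *\<^sub>R ?W 2 + \<sigma> *\<^sub>R E4"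
      by (simp add: E4_def algebra_simps)
    have "(1 / \<alpha>) *\<^sub>R T t ((1 / (2 * \<tau>)) *\<^sub>R (w (t + \<tau>) - w (t - \<tau>)))
        + L (\<sigma> *\<^sub>R w (t + \<tau>) + (1 - 2 * \<sigma>) *\<^sub>R w t + \<sigma> *\<^sub>R w (t - \<tau>))
      = (1 / \<alpha>) *\<^sub>R (T t (?W 1) + (\<tau>\<^sup>2 / 6) *\<^sub>R T t (?W 3) + (1 / (2 * \<tau>)) *\<^sub>R T t E5)
        + (L (w t) + (\<sigma> * \<tau>\<^sup>2) *\<^sub>R L (?W 2) + \<sigma> *\<^sub>R L E4)"
      unfolding central average
      using bounded_linear bounded_linear_T[of t] by (simp only: linear_simps)
    also have "\<dots> = (1 / (2 * \<alpha> * \<tau>)) *\<^sub>R T t E5 + \<sigma> *\<^sub>R L E4"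
    proof -
      have "1 / \<alpha> * - \<alpha> = -1" "1 / \<alpha> * (\<tau>\<^sup>2 / 6 * - (\<alpha> + 2)) = - (\<sigma> * \<tau>\<^sup>2)"
        using \<open>\<alpha> > 0\<close> by (simp_all add: \<sigma> field_simps)
      then show ?thesis
        unfolding T1 T3 scaleR_add_right scaleR_scaleR by (simp add: ac_simps)
    qed
    also have "norm \<dots> \<le> (1 / (2 * \<alpha> * \<tau>)) * norm (T t E5) + \<sigma> * norm (L E4)"
      using norm_triangle_ineq[of "(1 / (2 * \<alpha> * \<tau>)) *\<^sub>R T t E5" "\<sigma> *\<^sub>R L E4"] \<open>\<alpha> > 0\<close> \<tau> \<sigma>
      by simp
    also have "\<dots> \<le> (1 / (2 * \<alpha> * \<tau>)) * ((K + \<delta>) * (M5 * \<tau> ^ 5 / 60)) + \<sigma> * ((M4 * \<tau> ^ 4 / 12) * K)"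
    proof (intro add_mono mult_left_mono)
      have "norm (T t E5) \<le> t * norm (L E5) + \<delta> * norm E5"
        unfolding T_def using norm_triangle_ineq[of "t *\<^sub>R L E5" "\<delta> *\<^sub>R E5"] t \<delta>_pos by simp
      also have "\<dots> \<le> 1 * (norm E5 * K) + \<delta> * norm E5"
        using t K \<delta>_pos by (intro add_mono mult_mono) auto
      also have "\<dots> = (K + \<delta>) * norm E5" by (simp add: algebra_simps)
      also have "\<dots> \<le> (K + \<delta>) * (M5 * \<tau> ^ 5 / 60)"
        using K(1) \<delta>_pos by (intro mult_left_mono E5) auto
      finally show "norm (T t E5) \<le> (K + \<delta>) * (M5 * \<tau> ^ 5 / 60)" .
      show "norm (L E4) \<le> (M4 * \<tau> ^ 4 / 12) * K"
        using K(1) by (intro order_trans[OF K(2)] mult_right_mono E4) auto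
    qed (use \<open>\<alpha> > 0\<close> \<tau> \<sigma> in auto)
    also have "\<dots> = C * \<tau> ^ 4"
    proof -
      have "1 / (2 * \<alpha> * \<tau>) * ((K + \<delta>) * (M5 * (\<tau> * p) / 60)) = (K + \<delta>) * M5 / (120 * \<alpha>) * p" for p
        using \<tau>(1) \<open>\<alpha> > 0\<close> by simp
      moreover have "\<tau> ^ 5 = \<tau> * \<tau> ^ 4" by (simp add: eval_nat_numeral)
      ultimately show ?thesis by (simp add: C_def distrib_right)
    qed
    finally show "norm ((1 / \<alpha>) *\<^sub>R T t ((1 / (2 * \<tau>)) *\<^sub>R (w (t + \<tau>) - w (t - \<tau>)))
      + L (\<sigma> *\<^sub>R w (t + \<tau>) + (1 - 2 * \<sigma>) *\<^sub>R w t + \<sigma> *\<^sub>R w (t - \<tau>))) \<le> C * \<tau> ^ 4" .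
  qed
qed

end

end

theorem mainTheorem4:
  fixes \<Omega> :: "(real ^ 'd) set"
    and k c \<mu> :: "real ^ 'd \<Rightarrow> real"
    and k1 k2 c0 \<delta> \<alpha> \<sigma>\<^sub>0 :: real
    and V\<^sub>h :: "(real ^ 'd) l2fun set"
    and A :: "(real ^ 'd) l2fun \<Rightarrow> (real ^ 'd) l2fun"
    and \<psi> :: "(real ^ 'd) l2fun"
    and w :: "real \<Rightarrow> (real ^ 'd) l2fun"
  assumes dim: "CARD('d) \<in> {2, 3}"
    and domain: "bounded_lipschitz_domain \<Omega>"
    and V_sub: "V\<^sub>h \<subseteq> H1 \<Omega>"
    and V_fin: "finite_dim_subspace V\<^sub>h"
    and coeffs: "admissible_coeffs \<Omega> V\<^sub>h k c \<mu> k1 k2 c0"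
    and A_maps: "\<forall>u\<in>V\<^sub>h. A u \<in> V\<^sub>h"
    and A_def: "\<forall>u\<in>V\<^sub>h. \<forall>v\<in>V\<^sub>h. A u \<bullet> v = bilinear_a \<Omega> k c \<mu> u v"
    and A_selfadj: "\<forall>u\<in>V\<^sub>h. \<forall>v\<in>V\<^sub>h. A u \<bullet> v = u \<bullet> A v"
    and \<delta>_pos: "\<delta> > 0"
    and A_lower: "\<forall>u\<in>V\<^sub>h. u \<noteq> 0 \<longrightarrow> A u \<bullet> u > \<delta> * (norm u)\<^sup>2"
    and \<alpha>: "0 < \<alpha>" "\<alpha> < 1"
    and \<psi>: "\<psi> \<in> V\<^sub>h"
    and w: "cauchy_solution V\<^sub>h A \<delta> \<alpha> \<psi> w"
    and \<sigma>: "\<sigma>\<^sub>0 = (2 + \<alpha>) / (6 * \<alpha>)"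
  shows "\<exists>C. \<forall>N::nat. N \<ge> 1 \<longrightarrow> (\<forall>n\<in>{1..N - 1}.
    let \<tau> = 1 / real N; t = (\<lambda>m::nat. real m * \<tau>) in
      norm (B_op A \<delta> \<alpha> (t n) ((1 / (2 * \<tau>)) *\<^sub>R (w (t (n + 1)) - w (t (n - 1))))
        + D_op A \<delta> (\<sigma>\<^sub>0 *\<^sub>R w (t (n + 1)) + (1 - 2 * \<sigma>\<^sub>0) *\<^sub>R w (t n) + \<sigma>\<^sub>0 *\<^sub>R w (t (n - 1))))
      \<le> C * \<tau> ^ 4)"
proof -
  have subspace: "subspace V\<^sub>h"
    using V_fin by (rule finite_dim_subspace_imp_subspace)
  have D_in: "D_op A \<delta> u \<in> V\<^sub>h" if "u \<in> V\<^sub>h" for u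
    using that A_maps subspace by (simp add: D_op_def subspace_diff subspace_scale)
  have D_selfadj: "D_op A \<delta> u \<bullet> v = u \<bullet> D_op A \<delta> v" if "u \<in> V\<^sub>h" "v \<in> V\<^sub>h" for u v
    using that A_selfadj by (simp add: D_op_def inner_diff_left inner_diff_right)
  \<comment> \<open>An element of the subspace orthogonal to the whole subspace vanishes, so symmetry
    forces linearity.\<close>
  have eqI: "u = v" if "u \<in> V\<^sub>h" "v \<in> V\<^sub>h" "\<And>z. z \<in> V\<^sub>h \<Longrightarrow> u \<bullet> z = v \<bullet> z" for u v
    using that(3)[of "u - v"] that(1,2) subspace
    by (metis eq_iff_diff_eq_0 inner_diff_left inner_eq_zero_iff subspace_diff)
  have add: "D_op A \<delta> (u + v) = D_op A \<delta> u + D_op A \<delta> v" if "u \<in> V\<^sub>h" "v \<in> V\<^sub>h" for u v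
    using that subspace
    by (intro eqI) (simp_all add: D_in D_selfadj subspace_add inner_add_left)
  have scale: "D_op A \<delta> (r *\<^sub>R u) = r *\<^sub>R D_op A \<delta> u" if "u \<in> V\<^sub>h" for r u
    using that subspace
    by (intro eqI) (simp_all add: D_in D_selfadj subspace_scale)
  obtain L where L: "bounded_linear L" "\<And>u. u \<in> V\<^sub>h \<Longrightarrow> L u = D_op A \<delta> u"
    using bounded_linear_extension[OF V_fin add scale] by blast
  have accretive: "0 \<le> L u \<bullet> u" if "u \<in> V\<^sub>h" for u
  proof (cases "u = 0")
    case False
    then show ?thesis
      using that A_lower L(2)
      by (simp add: D_op_def inner_diff_left power2_norm_eq_inner less_imp_le)
  qed simp
  interpret accretive_operator V\<^sub>h L \<delta>
    by (rule accretive_operator.intro) (use V_fin L D_in accretive \<delta>_pos in auto)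
  have B_eq: "B_op A \<delta> \<alpha> t u = (1 / \<alpha>) *\<^sub>R T t u" if "u \<in> V\<^sub>h" for t u
    using that L(2) by (simp add: B_op_def T_def)
  have w_in: "w t \<in> V\<^sub>h" if "t \<in> {0..1}" for t
    using w that by (simp add: cauchy_solution_def)
  have w_cont: "continuous_on {0..1} w"
    using w by (simp add: cauchy_solution_def)
  have w_deriv: "\<exists>w'\<in>V\<^sub>h. (w has_vector_derivative w') (at t) \<and> T t w' = - \<alpha> *\<^sub>R L (w t)"
    if t: "t \<in> {0<..<1}" for t
  proof -
    obtain w' where w': "w' \<in> V\<^sub>h" "(w has_vector_derivative w') (at t within {0..1})"
      "B_op A \<delta> \<alpha> t w' + D_op A \<delta> (w t) = 0"
      using w t unfolding cauchy_solution_def by fastforce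
    have "\<alpha> *\<^sub>R ((1 / \<alpha>) *\<^sub>R T t w' + L (w t)) = 0"
      using w' t L(2) w_in by (simp add: B_eq)
    then have "T t w' = - \<alpha> *\<^sub>R L (w t)"
      using \<alpha>(1) by (simp add: scaleR_add_right add_eq_0_iff2)
    moreover have "(w has_vector_derivative w') (at t)"
      using w'(2) t at_within_Icc_at[of 0 t 1] by simp
    ultimately show ?thesis using w'(1) by blast
  qed
  obtain C where C: "\<And>t \<tau>. 0 < \<tau> \<Longrightarrow> 0 \<le> t - \<tau> \<Longrightarrow> t + \<tau> \<le> 1 \<Longrightarrow>
    norm ((1 / \<alpha>) *\<^sub>R T t ((1 / (2 * \<tau>)) *\<^sub>R (w (t + \<tau>) - w (t - \<tau>)))
      + L (\<sigma>\<^sub>0 *\<^sub>R w (t + \<tau>) + (1 - 2 * \<sigma>\<^sub>0) *\<^sub>R w t + \<sigma>\<^sub>0 *\<^sub>R w (t - \<tau>))) \<le> C * \<tau> ^ 4"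
    using residual_bound[OF w_in w_cont w_deriv \<alpha>(1) \<sigma>] by blast
  show ?thesis
    unfolding Let_def
  proof (intro exI[of _ C] allI impI ballI)
    fix N n :: nat assume N: "1 \<le> N" and n: "n \<in> {1..N - 1}"
    define \<tau> where "\<tau> = 1 / real N"
    define t where "t = real n * \<tau>"
    have \<tau>: "0 < \<tau>" using N by (simp add: \<tau>_def)
    have t_pm: "real (n + 1) * \<tau> = t + \<tau>" "real (n - 1) * \<tau> = t - \<tau>"
      using n by (simp_all add: t_def algebra_simps of_nat_diff)
    have lower: "0 \<le> t - \<tau>"
      using \<tau> by (simp flip: t_pm)
    have "real (n + 1) * \<tau> \<le> real N * \<tau>"
      using n N \<tau> by (intro mult_right_mono) auto
    moreover have "real N * \<tau> = 1" using N by (simp add: \<tau>_def)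
    ultimately have upper: "t + \<tau> \<le> 1" by (simp only: t_pm)
    have in_V: "w (t + \<tau>) \<in> V\<^sub>h" "w (t - \<tau>) \<in> V\<^sub>h" "w t \<in> V\<^sub>h"
      using \<tau> lower upper by (auto intro!: w_in)
    have "norm (B_op A \<delta> \<alpha> t ((1 / (2 * \<tau>)) *\<^sub>R (w (t + \<tau>) - w (t - \<tau>)))
        + D_op A \<delta> (\<sigma>\<^sub>0 *\<^sub>R w (t + \<tau>) + (1 - 2 * \<sigma>\<^sub>0) *\<^sub>R w t + \<sigma>\<^sub>0 *\<^sub>R w (t - \<tau>))) \<le> C * \<tau> ^ 4"
      using C[OF \<tau> lower upper] in_V subspace
      by (simp add: B_eq L(2) subspace_add subspace_diff subspace_scale)
    then show "norm (B_op A \<delta> \<alpha> (real n * (1 / real N))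
        ((1 / (2 * (1 / real N))) *\<^sub>R (w (real (n + 1) * (1 / real N)) - w (real (n - 1) * (1 / real N))))
        + D_op A \<delta> (\<sigma>\<^sub>0 *\<^sub>R w (real (n + 1) * (1 / real N)) + (1 - 2 * \<sigma>\<^sub>0) *\<^sub>R w (real n * (1 / real N))
          + \<sigma>\<^sub>0 *\<^sub>R w (real (n - 1) * (1 / real N)))) \<le> C * (1 / real N) ^ 4"
      unfolding \<tau>_def[symmetric] t_pm t_def[symmetric] .
  qed
qed

end
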